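(* Let $F_0:M\to\mathbb{R}^{n+1}$ be an immersion and $f:M\to\mathbb{R}$ a function. Within the class of flows $F:[0,T)\times M\to\mathbb{R}^{n+1}$ whose velocity vector is initially normal to the hypersurface, i.e. $$F(0,x)=F_0(x),\qquad \frac{d}{dt}F(0,x)=f(x)\,\nu(0,x),$$ the following two properties hold: (1) the flow $F$ is a solution to (HMCF) if and only if it is a solution of the normal flow equation (HMCF'); (2) any solution of (HMCF') satisfies $S=0$ for all $t\in[0,T)$; in other words, there exists a family of functions $\sigma:[0,T)\times M\to\mathbb{R}$ such that $\sigma(0,x)=f(x)$ and $\frac{d}{dt}F(t,x)=\sigma(t,x)\,\nu(t,x)$.
   Context: $M$ is an orientable smooth $n$-dimensional manifold; a flow is a smooth family of immersions $F:[0,T)\times M\to\mathbb{R}^{n+1}$. $\frac{d}{dt}$ is the time derivative at a fixed point of $M$; in local coordinates $F_i:=\partial F/\partial x^i$; $g_{ij}:=\langle F_i,F_j\rangle$ is the induced metric, with Levi-Civita connection $\nabla$; indices are raised with $g^{ij}$; the gradient of a function $p$ on $M$ is identified with $\nabla p=\nabla^ip\,F_i$. $\nu$ is the unit normal along the hypersurface (inward pointing when $M$ is compact without boundary), $h_{ij}:=-\langle F_i,\nabla_j\nu\rangle$, $H:=g^{ij}h_{ij}$. $\sigma:=\langle\frac{dF}{dt},\nu\rangle$, $S_i:=\langle\frac{dF}{dt},F_i\rangle$, $d^\dagger S:=\nabla^iS_i$, $e:=\frac12\left(\left|\frac{dF}{dt}\right|^2+n\right)$. The equation (HMCF) is $$\frac{d^2}{dt^2}F=\big((e-|S|^2)H-\sigma\,d^\dagger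 S\big)\nu+\big((\sigma H-d^\dagger S)S^k-\nabla^ke\big)F_k.$$ The equation (HMCF') is $$\frac{d^2}{dt^2}F=e\,H\nu-\nabla e,\qquad \left(\frac{dF}{dt}\right)^{\top}\Big|_{t=0}=0,$$ where $\top$ denotes the tangential part. *)

theory Defs
  imports "HOL-Analysis.Analysis"
begin

section \<open>Smooth maps between Euclidean spaces\<close>

text \<open>\<open>Ck_on k f W\<close> is only meant for open \<open>W\<close>: all iterated directional derivatives of order at
  most \<open>k\<close> exist and are continuous.\<close>

primrec Ck_on ::
  "nat \<Rightarrow> ('a::euclidean_space \<Rightarrow> 'b::euclidean_space) \<Rightarrow> 'a set \<Rightarrow> bool" where
  "Ck_on 0 f W \<longleftrightarrow> continuous_on W f"
| "Ck_on (Suc k) f W \<longleftrightarrow>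
     (\<forall>x\<in>W. f differentiable (at x)) \<and> (\<forall>v. Ck_on k (\<lambda>x. frechet_derivative f (at x) v) W)"

text \<open>On a set that need not be open (such as \<open>[0,T) \<times> V\<close>), a map is smooth if near each point of
  the set it has a smooth extension to an open neighbourhood.\<close>

definition smooth_on ::
  "'a::euclidean_space set \<Rightarrow> ('a \<Rightarrow> 'b::euclidean_space) \<Rightarrow> bool" where
  "smooth_on A f \<longleftrightarrow>
     (\<forall>a\<in>A. \<exists>W g. open W \<and> a \<in> W \<and> (\<forall>k. Ck_on k g W) \<and> (\<forall>x\<in>A \<inter> W. g x = f x))"

section \<open>Smooth manifolds\<close>

text \<open>The manifold is the whole type \<open>'m\<close>, and its dimension is \<open>CARD('n)\<close>. A chart consists of its
  domain and its coordinate map.\<close>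

type_synonym ('m, 'n) chart = "'m set \<times> ('m \<Rightarrow> real ^ 'n)"

abbreviation cdom :: "('m, 'n) chart \<Rightarrow> 'm set" where
  "cdom c \<equiv> fst c"

abbreviation coord :: "('m, 'n) chart \<Rightarrow> 'm \<Rightarrow> real ^ 'n" where
  "coord c \<equiv> snd c"

abbreviation crange :: "('m, 'n) chart \<Rightarrow> (real ^ 'n) set" where
  "crange c \<equiv> coord c ` cdom c"

abbreviation param :: "('m, 'n) chart \<Rightarrow> real ^ 'n \<Rightarrow> 'm" where
  "param c \<equiv> inv_into (cdom c) (coord c)"

definition is_chart :: "('m::topological_space, 'n::finite) chart \<Rightarrow> bool" where
  "is_chart c \<longleftrightarrow>
     open (cdom c) \<and> open (crange c) \<and> homeomorphism (cdom c) (crange c) (coord c) (param c)"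

definition smooth_atlas :: "('m::topological_space, 'n::finite) chart set \<Rightarrow> bool" where
  "smooth_atlas A \<longleftrightarrow>
     (\<forall>c\<in>A. is_chart c) \<and> (\<Union>c\<in>A. cdom c) = UNIV \<and>
     (\<forall>c\<in>A. \<forall>d\<in>A. smooth_on (coord c ` (cdom c \<inter> cdom d)) (coord d \<circ> param c))"

definition oriented_atlas :: "('m::topological_space, 'n::finite) chart set \<Rightarrow> bool" where
  "oriented_atlas B \<longleftrightarrow>
     smooth_atlas B \<and>
     (\<forall>c\<in>B. \<forall>d\<in>B. \<forall>x\<in>cdom c \<inter> cdom d.
        det (matrix (frechet_derivative (coord d \<circ> param c) (at (coord c x)))) > 0)"

text \<open>The second conjunct says that the smooth structure given by \<open>A\<close> contains an oriented atlas
  (the atlas \<open>A\<close> itself need not be oriented, nor maximal).\<close>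

definition orientable_smooth_manifold ::
  "('m::{t2_space,second_countable_topology}, 'n::finite) chart set \<Rightarrow> bool" where
  "orientable_smooth_manifold A \<longleftrightarrow>
     smooth_atlas A \<and> (\<exists>B. oriented_atlas B \<and> smooth_atlas (A \<union> B))"

text \<open>\<open>pd c i P x\<close> is \<open>\<partial>P/\<partial>x\<^sup>i\<close> at the point \<open>x\<close> in the local coordinates of the chart \<open>c\<close>.\<close>

definition pd ::
  "('m, 'n::finite) chart \<Rightarrow> 'n \<Rightarrow> ('m \<Rightarrow> 'b::euclidean_space) \<Rightarrow> 'm \<Rightarrow> 'b" where
  "pd c i P x = frechet_derivative (P \<circ> param c) (at (coord c x)) (axis i 1)"

definition immersion ::
  "('m::topological_space, 'n::finite) chart set \<Rightarrow> ('m \<Rightarrow> 'b::euclidean_space) \<Rightarrow> bool" where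
  "immersion A X \<longleftrightarrow>
     (\<forall>c\<in>A. smooth_on (crange c) (X \<circ> param c)) \<and>
     (\<forall>c\<in>A. \<forall>x\<in>cdom c. inj (frechet_derivative (X \<circ> param c) (at (coord c x))))"

section \<open>Time-dependent maps and flows\<close>

text \<open>The time interval \<open>[0,T)\<close>, where \<open>T = \<infinity>\<close> is allowed.\<close>

definition time_ivl :: "ereal \<Rightarrow> real set" where
  "time_ivl T = {t. 0 \<le> t \<and> ereal t < T}"

text \<open>Time derivatives are one-sided at \<open>t = 0\<close>.\<close>

definition ddt :: "ereal \<Rightarrow> (real \<Rightarrow> 'm \<Rightarrow> 'b::euclidean_space) \<Rightarrow> real \<Rightarrow> 'm \<Rightarrow> 'b" where
  "ddt T P t x = vector_derivative (\<lambda>s. P s x) (at t within time_ivl T)"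

definition smooth_family ::
  "('m::topological_space, 'n::finite) chart set \<Rightarrow> ereal \<Rightarrow>
     (real \<Rightarrow> 'm \<Rightarrow> 'b::euclidean_space) \<Rightarrow> bool" where
  "smooth_family A T P \<longleftrightarrow>
     (\<forall>c\<in>A. smooth_on (time_ivl T \<times> crange c) (\<lambda>(t, y). P t (param c y)))"

definition is_flow ::
  "('m::topological_space, 'n::finite) chart set \<Rightarrow> ereal \<Rightarrow>
     (real \<Rightarrow> 'm \<Rightarrow> 'b::euclidean_space) \<Rightarrow> bool" where
  "is_flow A T F \<longleftrightarrow> smooth_family A T F \<and> (\<forall>t\<in>time_ivl T. immersion A (F t))"

definition unit_normal ::
  "('m::topological_space, 'n::finite) chart set \<Rightarrow> ereal \<Rightarrow>
     (real \<Rightarrow> 'm \<Rightarrow> 'b::euclidean_space) \<Rightarrow> (real \<Rightarrow> 'm \<Rightarrow> 'b) \<Rightarrow> bool" where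
  "unit_normal A T F \<nu> \<longleftrightarrow>
     smooth_family A T \<nu> \<and>
     (\<forall>t\<in>time_ivl T. \<forall>c\<in>A. \<forall>x\<in>cdom c.
        norm (\<nu> t x) = 1 \<and> (\<forall>i. \<nu> t x \<bullet> pd c i (F t) x = 0))"

section \<open>Geometry of an immersed hypersurface in local coordinates\<close>

text \<open>Below, \<open>X\<close> is an immersion, \<open>N\<close> a unit normal along it, and \<open>V\<close> a vector field along it (the
  velocity of the flow at a fixed time). All components refer to the chart \<open>c\<close>.\<close>

definition metric ::
  "('m, 'n::finite) chart \<Rightarrow> ('m \<Rightarrow> 'b::euclidean_space) \<Rightarrow> 'm \<Rightarrow> real ^ 'n ^ 'n" where
  "metric c X x = (\<chi> i j. pd c i X x \<bullet> pd c j X x)"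

definition metric_inv ::
  "('m, 'n::finite) chart \<Rightarrow> ('m \<Rightarrow> 'b::euclidean_space) \<Rightarrow> 'm \<Rightarrow> real ^ 'n ^ 'n" where
  "metric_inv c X x = matrix_inv (metric c X x)"

text \<open>\<open>christoffel c X k i j\<close> is \<open>\<Gamma>\<^sup>k\<^sub>i\<^sub>j\<close> of the Levi-Civita connection of the induced metric.\<close>

definition christoffel ::
  "('m, 'n::finite) chart \<Rightarrow> ('m \<Rightarrow> 'b::euclidean_space) \<Rightarrow> 'n \<Rightarrow> 'n \<Rightarrow> 'n \<Rightarrow> 'm \<Rightarrow> real" where
  "christoffel c X k i j x =
     (\<Sum>l\<in>UNIV. metric_inv c X x $ k $ l *
        (pd c i (\<lambda>y. metric c X y $ j $ l) x + pd c j (\<lambda>y. metric c X y $ i $ l) x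
          - pd c l (\<lambda>y. metric c X y $ i $ j) x)) / 2"

text \<open>\<open>raise_index c X \<omega> k\<close> is \<open>g\<^sup>k\<^sup>j \<omega>\<^sub>j\<close>.\<close>

definition raise_index ::
  "('m, 'n::finite) chart \<Rightarrow> ('m \<Rightarrow> 'b::euclidean_space) \<Rightarrow> ('n \<Rightarrow> 'm \<Rightarrow> real) \<Rightarrow> 'n \<Rightarrow> 'm \<Rightarrow> real"
  where "raise_index c X \<omega> k x = (\<Sum>j\<in>UNIV. metric_inv c X x $ k $ j * \<omega> j x)"

text \<open>\<open>nabla_form c X \<omega> i j\<close> is \<open>\<nabla>\<^sub>i \<omega>\<^sub>j\<close>, and \<open>div_form c X \<omega>\<close> is \<open>\<nabla>\<^sup>i \<omega>\<^sub>i = g\<^sup>i\<^sup>j \<nabla>\<^sub>i \<omega>\<^sub>j\<close>.\<close>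

definition nabla_form ::
  "('m, 'n::finite) chart \<Rightarrow> ('m \<Rightarrow> 'b::euclidean_space) \<Rightarrow> ('n \<Rightarrow> 'm \<Rightarrow> real) \<Rightarrow>
     'n \<Rightarrow> 'n \<Rightarrow> 'm \<Rightarrow> real" where
  "nabla_form c X \<omega> i j x = pd c i (\<omega> j) x - (\<Sum>k\<in>UNIV. christoffel c X k i j x * \<omega> k x)"

definition div_form ::
  "('m, 'n::finite) chart \<Rightarrow> ('m \<Rightarrow> 'b::euclidean_space) \<Rightarrow> ('n \<Rightarrow> 'm \<Rightarrow> real) \<Rightarrow> 'm \<Rightarrow> real"
  where "div_form c X \<omega> x =
     (\<Sum>i\<in>UNIV. \<Sum>j\<in>UNIV. metric_inv c X x $ i $ j * nabla_form c X \<omega> i j x)"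

text \<open>\<open>grad_comp c X p k\<close> is \<open>\<nabla>\<^sup>k p\<close>, and \<open>gradient c X p\<close> is \<open>\<nabla>p = \<nabla>\<^sup>k p X\<^sub>k\<close>.\<close>

definition grad_comp ::
  "('m, 'n::finite) chart \<Rightarrow> ('m \<Rightarrow> 'b::euclidean_space) \<Rightarrow> ('m \<Rightarrow> real) \<Rightarrow> 'n \<Rightarrow> 'm \<Rightarrow> real" where
  "grad_comp c X p = raise_index c X (\<lambda>j. pd c j p)"

definition gradient ::
  "('m, 'n::finite) chart \<Rightarrow> ('m \<Rightarrow> 'b::euclidean_space) \<Rightarrow> ('m \<Rightarrow> real) \<Rightarrow> 'm \<Rightarrow> 'b" where
  "gradient c X p x = (\<Sum>k\<in>UNIV. grad_comp c X p k x *\<^sub>R pd c k X x)"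

definition second_form ::
  "('m, 'n::finite) chart \<Rightarrow> ('m \<Rightarrow> 'b::euclidean_space) \<Rightarrow> ('m \<Rightarrow> 'b) \<Rightarrow> 'm \<Rightarrow> real ^ 'n ^ 'n"
  where "second_form c X N x = (\<chi> i j. - (pd c i X x \<bullet> pd c j N x))"

definition mean_curvature ::
  "('m, 'n::finite) chart \<Rightarrow> ('m \<Rightarrow> 'b::euclidean_space) \<Rightarrow> ('m \<Rightarrow> 'b) \<Rightarrow> 'm \<Rightarrow> real" where
  "mean_curvature c X N x =
     (\<Sum>i\<in>UNIV. \<Sum>j\<in>UNIV. metric_inv c X x $ i $ j * second_form c X N x $ i $ j)"

definition normal_speed :: "('m \<Rightarrow> 'b::euclidean_space) \<Rightarrow> ('m \<Rightarrow> 'b) \<Rightarrow> 'm \<Rightarrow> real" where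
  "normal_speed V N x = V x \<bullet> N x"

definition tan_form ::
  "('m, 'n::finite) chart \<Rightarrow> ('m \<Rightarrow> 'b::euclidean_space) \<Rightarrow> ('m \<Rightarrow> 'b) \<Rightarrow> 'n \<Rightarrow> 'm \<Rightarrow> real" where
  "tan_form c X V i x = V x \<bullet> pd c i X x"

definition form_norm_sq ::
  "('m, 'n::finite) chart \<Rightarrow> ('m \<Rightarrow> 'b::euclidean_space) \<Rightarrow> ('n \<Rightarrow> 'm \<Rightarrow> real) \<Rightarrow> 'm \<Rightarrow> real"
  where "form_norm_sq c X \<omega> x =
     (\<Sum>i\<in>UNIV. \<Sum>j\<in>UNIV. metric_inv c X x $ i $ j * \<omega> i x * \<omega> j x)"

definition energy :: "nat \<Rightarrow> ('m \<Rightarrow> 'b::euclidean_space) \<Rightarrow> 'm \<Rightarrow> real" where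
  "energy n V x = ((norm (V x))\<^sup>2 + real n) / 2"

definition tangential_part :: "('m \<Rightarrow> 'b::euclidean_space) \<Rightarrow> ('m \<Rightarrow> 'b) \<Rightarrow> 'm \<Rightarrow> 'b" where
  "tangential_part N V x = V x - (V x \<bullet> N x) *\<^sub>R N x"

section \<open>The two flow equations\<close>

definition HMCF_rhs ::
  "('m, 'n::finite) chart \<Rightarrow> ('m \<Rightarrow> 'b::euclidean_space) \<Rightarrow> ('m \<Rightarrow> 'b) \<Rightarrow> ('m \<Rightarrow> 'b) \<Rightarrow> 'm \<Rightarrow> 'b"
  where "HMCF_rhs c X N V x =
     (let e = energy CARD('n) V; H = mean_curvature c X N x; \<sigma> = normal_speed V N x;
          S = tan_form c X V; dS = div_form c X S x
      in ((e x - form_norm_sq c X S x) * H - \<sigma> * dS) *\<^sub>R N x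
         + (\<Sum>k\<in>UNIV. ((\<sigma> * H - dS) * raise_index c X S k x - grad_comp c X e k x) *\<^sub>R pd c k X x))"

definition HMCF ::
  "('m, 'n::finite) chart set \<Rightarrow> ereal \<Rightarrow> (real \<Rightarrow> 'm \<Rightarrow> 'b::euclidean_space) \<Rightarrow>
     (real \<Rightarrow> 'm \<Rightarrow> 'b) \<Rightarrow> bool" where
  "HMCF A T F \<nu> \<longleftrightarrow>
     (\<forall>t\<in>time_ivl T. \<forall>c\<in>A. \<forall>x\<in>cdom c.
        ddt T (ddt T F) t x = HMCF_rhs c (F t) (\<nu> t) (ddt T F t) x)"

definition HMCF' ::
  "('m, 'n::finite) chart set \<Rightarrow> ereal \<Rightarrow> (real \<Rightarrow> 'm \<Rightarrow> 'b::euclidean_space) \<Rightarrow>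
     (real \<Rightarrow> 'm \<Rightarrow> 'b) \<Rightarrow> bool" where
  "HMCF' A T F \<nu> \<longleftrightarrow>
     (\<forall>t\<in>time_ivl T. \<forall>c\<in>A. \<forall>x\<in>cdom c.
        ddt T (ddt T F) t x =
          (let e = energy CARD('n) (ddt T F t)
           in (e x * mean_curvature c (F t) (\<nu> t) x) *\<^sub>R \<nu> t x - gradient c (F t) e x)) \<and>
     (\<forall>x. tangential_part (\<nu> 0) (ddt T F 0) x = 0)"

end

theory Submission
  imports Defs
begin

text \<open>By symmetry of second derivatives and \<open>\<partial>\<^sub>i e = \<langle>\<partial>\<^sub>t F, \<partial>\<^sub>i \<partial>\<^sub>t F\<rangle>\<close>, the energy gradient drops out of
  \<open>\<partial>\<^sub>t S\<^sub>i = \<langle>\<partial>\<^sub>t\<^sup>2 F, F\<^sub>i\<rangle> + \<langle>\<partial>\<^sub>t F, \<partial>\<^sub>t F\<^sub>i\<rangle>\<close>. Hence \<open>\<partial>\<^sub>t S\<^sub>i = (\<sigma> H - d\<^sup>\<dagger>S) S\<^sub>i\<close> under (HMCF), and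
  \<open>\<partial>\<^sub>t S\<^sub>i = 0\<close> under (HMCF'). At a fixed point of the manifold the former is a linear homogeneous
  ordinary differential equation with continuous coefficient \<open>\<sigma> H - d\<^sup>\<dagger>S\<close>, so no uniqueness theory for
  partial differential equations is needed: \<open>S = 0\<close> initially forces \<open>S = 0\<close> at all times in both cases.
  For \<open>S = 0\<close> the right-hand sides of the two equations coincide, and the velocity is normal.\<close>

section \<open>Calculus of smooth maps\<close>

lemma Ck_on_Suc_has_derivative:
  assumes "Ck_on (Suc k) f W" "x \<in> W"
  shows "(f has_derivative frechet_derivative f (at x)) (at x)"
  using assms by (simp add: frechet_derivative_works)

lemma Ck_on_SucD: "Ck_on (Suc k) f W \<Longrightarrow> Ck_on k f W"
proof (induction k arbitrary: f)
  case 0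
  then show ?case
    by (auto intro!: continuous_at_imp_continuous_on differentiable_imp_continuous_within)
next
  case (Suc k)
  then show ?case by (metis Ck_on.simps(2))
qed

lemma Ck_on_subset: "Ck_on k f W \<Longrightarrow> W' \<subseteq> W \<Longrightarrow> Ck_on k f W'"
  by (induction k arbitrary: f) (auto intro: continuous_on_subset)

text \<open>Since \<open>W\<close> is open, the derivative at a point of \<open>W\<close> depends
  only on values in \<open>W\<close>, so \<open>f\<close> and \<open>g\<close> have the same
  directional derivatives there and the induction continues with them. This is how a derivative
  formula valid only on \<open>W\<close> can replace \<open>frechet_derivative\<close>.\<close>

lemma Ck_on_cong:
  assumes "open W" "\<And>x. x \<in> W \<Longrightarrow> f x = g x" "Ck_on k f W"
  shows "Ck_on k g W"
  using assms(2,3)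
proof (induction k arbitrary: f g)
  case 0
  then show ?case by (simp cong: continuous_on_cong)
next
  case (Suc k)
  have D: "(g has_derivative frechet_derivative f (at x)) (at x)" if "x \<in> W" for x
    using has_derivative_transform_within_open[OF Ck_on_Suc_has_derivative[OF Suc.prems(2) that]
        \<open>open W\<close> that] Suc.prems(1) by simp
  have "Ck_on k (\<lambda>x. frechet_derivative g (at x) v) W" for v
  proof (rule Suc.IH)
    show "Ck_on k (\<lambda>x. frechet_derivative f (at x) v) W"
      using Suc.prems(2) by simp
  qed (simp add: frechet_derivative_at[OF D, symmetric])
  then show ?case
    using D by (auto simp: differentiable_def)
qed

lemma Ck_on_const: "Ck_on k (\<lambda>x. c) W"
  by (induction k arbitrary: c) auto

lemma Ck_on_add:
  assumes "open W" "Ck_on k f W" "Ck_on k g W"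
  shows "Ck_on k (\<lambda>x. f x + g x) W"
  using assms(2,3)
proof (induction k arbitrary: f g)
  case 0
  then show ?case by (auto intro: continuous_intros)
next
  case (Suc k)
  have D: "((\<lambda>x. f x + g x) has_derivative
      (\<lambda>v. frechet_derivative f (at x) v + frechet_derivative g (at x) v)) (at x)" if "x \<in> W" for x
    using Suc.prems that by (intro has_derivative_add Ck_on_Suc_has_derivative)
  have "Ck_on k (\<lambda>x. frechet_derivative (\<lambda>x. f x + g x) (at x) v) W" for v
  proof (rule Ck_on_cong[OF \<open>open W\<close>])
    show "Ck_on k (\<lambda>x. frechet_derivative f (at x) v + frechet_derivative g (at x) v) W"
      using Suc.prems by (intro Suc.IH) auto
  qed (simp add: frechet_derivative_at[OF D, symmetric])
  then show ?case
    using D by (auto simp: differentiable_def)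
qed

text \<open>By the Leibniz rule the derivative is a sum of two terms of the same bilinear form. In
  each, one factor is a derivative and the other has lost one order through
  \<open>Ck_on_SucD\<close>, so the induction hypothesis applies to both.\<close>

lemma Ck_on_bilinear:
  assumes "bounded_bilinear B" "open W" "Ck_on k f W" "Ck_on k g W"
  shows "Ck_on k (\<lambda>x. B (f x) (g x)) W"
  using assms(3,4)
proof (induction k arbitrary: f g)
  case 0
  then show ?case by (auto intro: bounded_bilinear.continuous_on[OF assms(1)])
next
  case (Suc k)
  have D: "((\<lambda>x. B (f x) (g x)) has_derivative
      (\<lambda>v. B (f x) (frechet_derivative g (at x) v) + B (frechet_derivative f (at x) v) (g x))) (at x)"
    if "x \<in> W" for x
    using Suc.prems that by (intro bounded_bilinear.FDERIV[OF assms(1)] Ck_on_Suc_has_derivative)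
  have "Ck_on k (\<lambda>x. frechet_derivative (\<lambda>x. B (f x) (g x)) (at x) v) W" for v
  proof (rule Ck_on_cong[OF \<open>open W\<close>])
    show "Ck_on k (\<lambda>x. B (f x) (frechet_derivative g (at x) v) + B (frechet_derivative f (at x) v) (g x)) W"
      using Suc.prems Ck_on_SucD[OF Suc.prems(1)] Ck_on_SucD[OF Suc.prems(2)]
      by (intro Ck_on_add[OF \<open>open W\<close>] Suc.IH) auto
  qed (simp add: frechet_derivative_at[OF D, symmetric])
  then show ?case
    using D by (auto simp: differentiable_def)
qed

section \<open>Symmetry of mixed second derivatives\<close>

lemma has_field_derivative_along_line:
  fixes f :: "'a::real_normed_vector \<Rightarrow> real"
  assumes "(f has_derivative f') (at (p + s *\<^sub>R u))"
  shows "((\<lambda>r. f (p + r *\<^sub>R u)) has_real_derivative f' u) (at s)"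
proof -
  have "((\<lambda>r. p + r *\<^sub>R u) has_derivative (\<lambda>h. h *\<^sub>R u)) (at s)"
    by (auto intro!: derivative_eq_intros)
  from has_derivative_compose[OF this assms]
  have "((\<lambda>r. f (p + r *\<^sub>R u)) has_derivative (\<lambda>h. f' (h *\<^sub>R u))) (at s)" .
  moreover have "f' (h *\<^sub>R u) = f' u * h" for h
    using linear_scale[OF has_derivative_linear[OF assms]] by simp
  ultimately show ?thesis
    by (simp add: has_field_derivative_def)
qed

text \<open>The left-hand side of the identity is symmetric in \<open>u\<close> and \<open>v\<close>; applying the lemma in both
  orders and letting \<open>h\<close> tend to 0 makes the two mixed derivatives agree.\<close>

lemma second_difference_mvt:
  fixes f :: "'a::euclidean_space \<Rightarrow> real"
  assumes "Ck_on 2 f W" "h > 0"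
    and box: "\<And>s r. \<lbrakk>0 \<le> s; s \<le> h; 0 \<le> r; r \<le> h\<rbrakk> \<Longrightarrow> a + s *\<^sub>R u + r *\<^sub>R v \<in> W"
  obtains s r where "0 < s" "s < h" "0 < r" "r < h"
    "f (a + h *\<^sub>R u + h *\<^sub>R v) - f (a + h *\<^sub>R u) - f (a + h *\<^sub>R v) + f a =
     h * (h * frechet_derivative (\<lambda>x. frechet_derivative f (at x) u) (at (a + s *\<^sub>R u + r *\<^sub>R v)) v)"
proof -
  let ?Du = "\<lambda>x. frechet_derivative f (at x) u"
  \<comment> \<open>The second difference is \<open>\<phi> h - \<phi> 0\<close>: the difference in
    direction \<open>v\<close> is taken first, then varied along \<open>u\<close>. The mean value
    theorem in \<open>s\<close> leaves a difference of \<open>?Du\<close> in direction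
    \<open>v\<close>, to which it is applied again in \<open>r\<close>.\<close>
  define \<phi> where "\<phi> s = f (a + h *\<^sub>R v + s *\<^sub>R u) - f (a + s *\<^sub>R u)" for s
  have C: "Ck_on (Suc 1) f W" "Ck_on (Suc 0) ?Du W"
    using assms(1) by (simp_all add: eval_nat_numeral)
  have "(\<phi> has_real_derivative ?Du (a + h *\<^sub>R v + s *\<^sub>R u) - ?Du (a + s *\<^sub>R u)) (at s)"
    if "0 \<le> s" "s \<le> h" for s
    unfolding \<phi>_def
    using box[OF that, of 0] box[OF that, of h] \<open>h > 0\<close>
    by (intro DERIV_diff has_field_derivative_along_line Ck_on_Suc_has_derivative[OF C(1)])
      (simp_all add: algebra_simps)
  from MVT2[OF \<open>h > 0\<close> this] obtain s where s: "0 < s" "s < h"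
    and 1: "\<phi> h - \<phi> 0 = h * (?Du (a + h *\<^sub>R v + s *\<^sub>R u) - ?Du (a + s *\<^sub>R u))"
    by auto
  define \<psi> where "\<psi> r = ?Du (a + s *\<^sub>R u + r *\<^sub>R v)" for r
  have "(\<psi> has_real_derivative
      frechet_derivative ?Du (at (a + s *\<^sub>R u + r *\<^sub>R v)) v) (at r)" if "0 \<le> r" "r \<le> h" for r
    unfolding \<psi>_def using box[of s r] s that
    by (intro has_field_derivative_along_line Ck_on_Suc_has_derivative[OF C(2)]) simp
  from MVT2[OF \<open>h > 0\<close> this] obtain r where r: "0 < r" "r < h"
    and 2: "\<psi> h - \<psi> 0 = h * frechet_derivative ?Du (at (a + s *\<^sub>R u + r *\<^sub>R v)) v"
    by auto
  show thesis
  proof (rule that[OF s r])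
    have "\<phi> h - \<phi> 0 = h * (\<psi> h - \<psi> 0)"
      using 1 by (simp add: \<psi>_def algebra_simps)
    then show "f (a + h *\<^sub>R u + h *\<^sub>R v) - f (a + h *\<^sub>R u) - f (a + h *\<^sub>R v) + f a =
        h * (h * frechet_derivative ?Du (at (a + s *\<^sub>R u + r *\<^sub>R v)) v)"
      unfolding 2 by (simp add: \<phi>_def algebra_simps)
  qed
qed

text \<open>If the two mixed derivatives differed at \<open>a\<close>, continuity would keep each
  within half the gap of its value at \<open>a\<close> on a small ball. The second difference makes
  a value of one equal to a value of the other inside that ball, which is impossible.\<close>

lemma Ck_on_mixed_derivatives_commute_real:
  fixes f :: "'a::euclidean_space \<Rightarrow> real"
  assumes C: "Ck_on 2 f W" and "open W" "a \<in> W"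
  shows "frechet_derivative (\<lambda>x. frechet_derivative f (at x) u) (at a) v =
         frechet_derivative (\<lambda>x. frechet_derivative f (at x) v) (at a) u"
    (is "?P a = ?Q a")
proof (rule ccontr)
  assume ne: "?P a \<noteq> ?Q a"
  define e where "e = \<bar>?P a - ?Q a\<bar> / 2"
  have "e > 0" using ne by (simp add: e_def)
  have "continuous_on W ?P" "continuous_on W ?Q"
    using C by (simp_all add: eval_nat_numeral)
  then have "isCont ?P a" "isCont ?Q a"
    using \<open>open W\<close> \<open>a \<in> W\<close> continuous_on_eq_continuous_at by blast+
  then obtain d1 d2 where d: "d1 > 0" "d2 > 0"
    "\<And>x. dist x a < d1 \<Longrightarrow> dist (?P x) (?P a) < e" "\<And>x. dist x a < d2 \<Longrightarrow> dist (?Q x) (?Q a) < e"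
    using \<open>e > 0\<close> unfolding continuous_at_eps_delta by metis
  obtain d3 where d3: "d3 > 0" "ball a d3 \<subseteq> W"
    using \<open>open W\<close> \<open>a \<in> W\<close> openE by blast
  define d where "d = min d1 (min d2 d3)"
  \<comment> \<open>The parallelogram spanned by \<open>h *\<^sub>R u\<close> and
    \<open>h *\<^sub>R v\<close> at \<open>a\<close> then lies within distance \<open>d / 2\<close>
    of \<open>a\<close>; the summand 1 keeps the denominator positive when
    \<open>u = v = 0\<close>.\<close>
  define h where "h = d / (2 * (norm u + norm v + 1))"
  have pos: "d > 0" "h > 0" using d d3 by (auto simp: d_def h_def intro!: divide_pos_pos add_nonneg_pos)
  have near: "dist (a + s *\<^sub>R u + r *\<^sub>R v) a < d" if "0 \<le> s" "s \<le> h" "0 \<le> r" "r \<le> h" for s r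
  proof -
    have "dist (a + s *\<^sub>R u + r *\<^sub>R v) a = norm (s *\<^sub>R u + r *\<^sub>R v)"
      by (simp add: dist_norm add.assoc)
    also have "\<dots> \<le> s * norm u + r * norm v"
      using that norm_triangle_ineq[of "s *\<^sub>R u" "r *\<^sub>R v"] by simp
    also have "\<dots> \<le> h * norm u + h * norm v"
      using that by (intro add_mono mult_right_mono) auto
    also have "\<dots> \<le> h * (norm u + norm v + 1)"
      using pos by (simp add: algebra_simps)
    also have "\<dots> = d / 2"
      using add_nonneg_pos[of "norm u + norm v" 1] unfolding h_def
      by (simp del: distrib_left_numeral)
    finally show ?thesis using pos by simp
  qed
  have inW: "a + s *\<^sub>R u + r *\<^sub>R v \<in> W" if "0 \<le> s" "s \<le> h" "0 \<le> r" "r \<le> h" for s r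
    using near[OF that] d3 by (auto simp: d_def dist_commute)
  have inW': "a + s *\<^sub>R v + r *\<^sub>R u \<in> W" if "0 \<le> s" "s \<le> h" "0 \<le> r" "r \<le> h" for s r
    using inW[of r s] that by (simp add: algebra_simps)
  obtain s r where sr: "0 < s" "s < h" "0 < r" "r < h"
    "f (a + h *\<^sub>R u + h *\<^sub>R v) - f (a + h *\<^sub>R u) - f (a + h *\<^sub>R v) + f a =
      h * (h * ?P (a + s *\<^sub>R u + r *\<^sub>R v))"
    by (rule second_difference_mvt[OF C pos(2) inW])
  obtain s' r' where sr': "0 < s'" "s' < h" "0 < r'" "r' < h"
    "f (a + h *\<^sub>R v + h *\<^sub>R u) - f (a + h *\<^sub>R v) - f (a + h *\<^sub>R u) + f a =
      h * (h * ?Q (a + s' *\<^sub>R v + r' *\<^sub>R u))"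
    by (rule second_difference_mvt[OF C pos(2) inW'])
  have "h * (h * ?P (a + s *\<^sub>R u + r *\<^sub>R v)) = h * (h * ?Q (a + s' *\<^sub>R v + r' *\<^sub>R u))"
    unfolding sr(5)[symmetric] sr'(5)[symmetric] by (simp add: add.assoc add.commute[of "h *\<^sub>R u"])
  then have eq: "?P (a + s *\<^sub>R u + r *\<^sub>R v) = ?Q (a + r' *\<^sub>R u + s' *\<^sub>R v)"
    using pos by (simp add: add.assoc add.commute[of "r' *\<^sub>R u"])
  have "dist (?P (a + s *\<^sub>R u + r *\<^sub>R v)) (?P a) < \<bar>?P a - ?Q a\<bar> / 2"
    using near[of s r] sr unfolding e_def[symmetric] by (intro d(3)) (simp add: d_def)
  moreover have "dist (?P (a + s *\<^sub>R u + r *\<^sub>R v)) (?Q a) < \<bar>?P a - ?Q a\<bar> / 2"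
    using near[of r' s'] sr' unfolding eq e_def[symmetric] by (intro d(4)) (simp add: d_def)
  ultimately have "dist (?P a) (?Q a) < \<bar>?P a - ?Q a\<bar>"
    by (rule dist_triangle_half_r)
  then show False by (simp add: dist_real_def)
qed

text \<open>Reduction to the real-valued case by taking the inner product with each basis vector
  \<open>b\<close>, which commutes with differentiation.\<close>

lemma Ck_on_mixed_derivatives_commute:
  fixes f :: "'a::euclidean_space \<Rightarrow> 'b::euclidean_space"
  assumes C: "Ck_on 2 f W" and W: "open W" "a \<in> W"
  shows "frechet_derivative (\<lambda>x. frechet_derivative f (at x) u) (at a) v =
         frechet_derivative (\<lambda>x. frechet_derivative f (at x) v) (at a) u"
proof (rule euclidean_eqI)
  fix b :: 'b
  have inner_derivative:
    "frechet_derivative (\<lambda>x. g x \<bullet> b) (at x) w = frechet_derivative g (at x) w \<bullet> b"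
    if "Ck_on (Suc k) g W" "x \<in> W" for g :: "'a \<Rightarrow> 'b" and k x w
    using frechet_derivative_at[OF has_derivative_inner_left[OF Ck_on_Suc_has_derivative[OF that]], of b]
    by metis
  have C': "Ck_on (Suc 1) f W" "Ck_on (Suc 0) (\<lambda>x. frechet_derivative f (at x) w) W" for w
    using C by (simp_all add: eval_nat_numeral)
  have second_derivative:
    "frechet_derivative (\<lambda>x. frechet_derivative (\<lambda>x. f x \<bullet> b) (at x) u) (at a) v =
     frechet_derivative (\<lambda>x. frechet_derivative f (at x) u) (at a) v \<bullet> b" for u v
  proof -
    have "((\<lambda>x. frechet_derivative f (at x) u \<bullet> b) has_derivative
        (\<lambda>v. frechet_derivative (\<lambda>x. frechet_derivative f (at x) u) (at a) v \<bullet> b)) (at a)"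
      by (intro has_derivative_inner_left Ck_on_Suc_has_derivative[OF C'(2) W(2)])
    \<comment> \<open>The component of the derivative and the derivative of the component are known
      to agree on \<open>W\<close> only, which suffices because \<open>W\<close> is open.\<close>
    then have "((\<lambda>x. frechet_derivative (\<lambda>x. f x \<bullet> b) (at x) u) has_derivative
        (\<lambda>v. frechet_derivative (\<lambda>x. frechet_derivative f (at x) u) (at a) v \<bullet> b)) (at a)"
      by (rule has_derivative_transform_within_open[OF _ W]) (simp add: inner_derivative[OF C'(1)])
    from frechet_derivative_at[OF this] show ?thesis by metis
  qed
  have "Ck_on 2 (\<lambda>x. f x \<bullet> b) W"
    by (rule Ck_on_bilinear[OF bounded_bilinear_inner W(1) C Ck_on_const])
  from Ck_on_mixed_derivatives_commute_real[OF this W]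
  show "frechet_derivative (\<lambda>x. frechet_derivative f (at x) u) (at a) v \<bullet> b =
        frechet_derivative (\<lambda>x. frechet_derivative f (at x) v) (at a) u \<bullet> b"
    by (simp only: second_derivative)
qed

section \<open>Linear differential equations and matrices\<close>

text \<open>A Gronwall argument on the compact interval \<open>{0..t}\<close>, where the continuous
  coefficient \<open>b\<close> is bounded even if it is unbounded on the whole time
  interval.\<close>

lemma linear_ode_zero:
  fixes u b :: "real \<Rightarrow> real"
  assumes t: "t \<in> time_ivl T"
    and b: "continuous_on (time_ivl T) b"
    and u: "\<And>s. s \<in> time_ivl T \<Longrightarrow> (u has_vector_derivative b s * u s) (at s within time_ivl T)"
    and "u 0 = 0"
  shows "u t = 0"
proof -
  have "0 \<le> t" using t by (simp add: time_ivl_def)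
  have sub: "{0..t} \<subseteq> time_ivl T"
    using t by (auto simp: time_ivl_def intro: le_less_trans[of "ereal _" "ereal t"])
  obtain K where K: "\<And>s. s \<in> {0..t} \<Longrightarrow> \<bar>b s\<bar> \<le> K"
    using compact_imp_bounded[OF compact_continuous_image[OF continuous_on_subset[OF b sub]]]
    unfolding bounded_iff by (metis compact_Icc imageI real_norm_def)
  \<comment> \<open>The weight makes \<open>w\<close> nonincreasing, and \<open>w\<close> is nonnegative with \<open>w 0 = 0\<close>.\<close>
  define w where "w s = (u s)\<^sup>2 * exp (- 2 * K * s)" for s
  have du: "(u has_real_derivative b s * u s) (at s within {0..t})" if "s \<in> {0..t}" for s
    using has_vector_derivative_within_subset[OF u sub] that sub
    by (auto simp: has_real_derivative_iff_has_vector_derivative)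
  have dw: "(w has_real_derivative 2 * (b s - K) * (u s)\<^sup>2 * exp (- 2 * K * s)) (at s within {0..t})"
    if "s \<in> {0..t}" for s
    unfolding w_def
    by (rule derivative_eq_intros du[OF that] refl)+ (simp add: algebra_simps power2_eq_square)
  have "w t \<le> w 0"
  \<comment> \<open>The derivatives at \<open>0\<close> and \<open>t\<close> are one-sided, so
    monotonicity is derived from the sign in the interior and continuity up to the
    endpoints.\<close>
  proof (rule DERIV_nonpos_imp_decreasing_open[OF \<open>0 \<le> t\<close>])
    fix s assume s: "0 < s" "s < t"
    have "(w has_real_derivative 2 * (b s - K) * (u s)\<^sup>2 * exp (- 2 * K * s)) (at s)"
      using dw[of s] s at_within_Icc_at[of 0 s t] by simp
    moreover have "b s \<le> K" using K[of s] s by simp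
    ultimately show "\<exists>y. (w has_real_derivative y) (at s) \<and> y \<le> 0"
      by (intro exI conjI) (auto intro!: mult_nonpos_nonneg)
  next
    show "continuous_on {0..t} w"
      by (rule DERIV_continuous_on[OF dw])
  qed
  then have "(u t)\<^sup>2 * exp (- 2 * K * t) \<le> 0"
    using \<open>u 0 = 0\<close> by (simp add: w_def)
  then show ?thesis
    by (simp add: mult_le_0_iff)
qed

section \<open>Matrices depending continuously on a parameter\<close>

lemma continuous_on_det:
  fixes A :: "'a::topological_space \<Rightarrow> real ^ 'n ^ 'n"
  assumes "\<And>i j. continuous_on S (\<lambda>t. A t $ i $ j)"
  shows "continuous_on S (\<lambda>t. det (A t))"
  unfolding det_def by (intro continuous_intros assms)

lemma matrix_inv_right:
  fixes A :: "'a::semiring_1 ^ 'n ^ 'm"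
  assumes "invertible A"
  shows "A ** matrix_inv A = mat 1"
  using someI_ex[OF assms[unfolded invertible_def]] by (simp add: matrix_inv_def)

lemma linear_axis_expansion:
  fixes D :: "real ^ 'n \<Rightarrow> 'b::real_vector"
  assumes "linear D"
  shows "D a = (\<Sum>i\<in>UNIV. a $ i *\<^sub>R D (axis i 1))"
  by (subst basis_expansion[of a, symmetric])
    (simp add: linear_sum[OF assms] linear_scale[OF assms] scalar_mult_eq_scaleR)

text \<open>Column \<open>l\<close> of the inverse solves the linear system with right-hand side
  \<open>axis l 1\<close>. Cramer's rule writes its \<open>k\<close>-th entry as a quotient of
  determinants, both continuous in \<open>t\<close>.\<close>

lemma continuous_on_matrix_inv:
  fixes A :: "'a::topological_space \<Rightarrow> real ^ 'n ^ 'n"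
  assumes A: "\<And>i j. continuous_on S (\<lambda>t. A t $ i $ j)"
    and inv: "\<And>t. t \<in> S \<Longrightarrow> invertible (A t)"
  shows "continuous_on S (\<lambda>t. matrix_inv (A t) $ k $ l)"
proof -
  let ?M = "\<lambda>t. \<chi> i j. if j = k then axis l 1 $ i else A t $ i $ j"
  have det: "det (A t) \<noteq> 0" if "t \<in> S" for t
    using inv[OF that] by (simp add: invertible_det_nz)
  have "matrix_inv (A t) $ k $ l = det (?M t) / det (A t)" if "t \<in> S" for t
  proof -
    have "A t *v (matrix_inv (A t) *v axis l 1) = axis l 1"
      by (simp add: matrix_vector_mul_assoc matrix_inv_right[OF inv[OF that]])
    then have "(matrix_inv (A t) *v axis l 1) $ k = det (?M t) / det (A t)"
      unfolding cramer[OF det[OF that]] by simp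
    then show ?thesis
      by (simp add: matrix_vector_mul_component inner_axis)
  qed
  moreover have "continuous_on S (\<lambda>t. det (?M t) / det (A t))"
  proof (intro continuous_on_divide continuous_on_det)
    show "continuous_on S (\<lambda>t. ?M t $ i $ j)" for i j
      using A by (cases "j = k") auto
  qed (use A det in auto)
  ultimately show ?thesis
    by (simp cong: continuous_on_cong)
qed

section \<open>Smooth time-dependent maps in a chart\<close>

lemma is_chart_open_crange: "is_chart c \<Longrightarrow> open (crange c)"
  by (simp add: is_chart_def)

lemma is_chart_param_coord: "is_chart c \<Longrightarrow> x \<in> cdom c \<Longrightarrow> param c (coord c x) = x"
  by (metis is_chart_def homeomorphism_def)

lemma is_chart_coord_param:
  "is_chart c \<Longrightarrow> y \<in> crange c \<Longrightarrow> param c y \<in> cdom c \<and> coord c (param c y) = y"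
  by (simp add: f_inv_into_f inv_into_into)

lemma time_ivl_right_interval:
  assumes "t \<in> time_ivl T"
  obtains t' where "t < t'" "{t..t'} \<subseteq> time_ivl T"
proof -
  obtain t' where "ereal t < ereal t'" "ereal t' < T"
    using assms ereal_dense2[of "ereal t" T] by (auto simp: time_ivl_def)
  then show thesis
    using assms by (intro that[of t']) (auto simp: time_ivl_def intro: le_less_trans[of "ereal _" "ereal t'"])
qed

text \<open>Nontriviality of this filter makes the derivative within the time interval unique, also
  at time 0, so that \<open>ddt\<close> can be computed from any
  \<open>has_vector_derivative\<close> fact.\<close>

lemma at_within_time_ivl_neq_bot:
  assumes "t \<in> time_ivl T"
  shows "at t within time_ivl T \<noteq> bot"
proof -
  obtain t' where "t < t'" "{t..t'} \<subseteq> time_ivl T"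
    using time_ivl_right_interval[OF assms] .
  then have "at t within {t..t'} \<le> at t within time_ivl T"
    by (intro at_le)
  moreover have "at t within {t..t'} \<noteq> bot"
    using \<open>t < t'\<close> by (simp add: at_within_Icc_at_right)
  ultimately show ?thesis
    by (metis bot.extremum_unique)
qed

text \<open>The map \<open>g\<close> is smooth on an open set that may reach negative times, so
  ordinary calculus applies to it even at time 0; it is tied to \<open>P\<close> only at times of
  the flow. Keeping \<open>W\<close> over \<open>crange c\<close> ensures that
  \<open>param c\<close> inverts the coordinates at every point of \<open>W\<close>.\<close>

definition local_extension ::
  "('m, 'n::finite) chart \<Rightarrow> ereal \<Rightarrow> (real \<Rightarrow> 'm \<Rightarrow> 'b::euclidean_space) \<Rightarrow>
     (real \<times> (real ^ 'n)) set \<Rightarrow> (real \<times> (real ^ 'n) \<Rightarrow> 'b) \<Rightarrow> bool" where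
  "local_extension c T P W g \<longleftrightarrow>
     open W \<and> W \<subseteq> UNIV \<times> crange c \<and> (\<forall>k. Ck_on k g W) \<and>
     (\<forall>s y. s \<in> time_ivl T \<longrightarrow> (s, y) \<in> W \<longrightarrow> P s (param c y) = g (s, y))"

definition smooth_in ::
  "('m, 'n::finite) chart \<Rightarrow> ereal \<Rightarrow> (real \<Rightarrow> 'm \<Rightarrow> 'b::euclidean_space) \<Rightarrow> bool" where
  "smooth_in c T P \<longleftrightarrow> smooth_on (time_ivl T \<times> crange c) (\<lambda>(t, y). P t (param c y))"

lemma smooth_family_iff_smooth_in: "smooth_family A T P \<longleftrightarrow> (\<forall>c\<in>A. smooth_in c T P)"
  by (simp add: smooth_family_def smooth_in_def)

lemma smooth_inI:
  assumes "\<And>t x. \<lbrakk>t \<in> time_ivl T; x \<in> cdom c\<rbrakk> \<Longrightarrow>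
      \<exists>W g. (t, coord c x) \<in> W \<and> local_extension c T P W g"
  shows "smooth_in c T P"
  unfolding smooth_in_def smooth_on_def
proof
  fix a assume "a \<in> time_ivl T \<times> crange c"
  then obtain t x where "a = (t, coord c x)" "t \<in> time_ivl T" "x \<in> cdom c"
    by auto
  with assms obtain W g where "a \<in> W" "local_extension c T P W g"
    by blast
  then show "\<exists>W g. open W \<and> a \<in> W \<and> (\<forall>k. Ck_on k g W) \<and>
      (\<forall>z\<in>(time_ivl T \<times> crange c) \<inter> W. g z = (case z of (t, y) \<Rightarrow> P t (param c y)))"
    by (intro exI[of _ W] exI[of _ g]) (auto simp: local_extension_def)
qed

lemma smooth_inE:
  assumes "is_chart c" "smooth_in c T P" "t \<in> time_ivl T" "x \<in> cdom c"
  obtains W g where "(t, coord c x) \<in> W" "local_extension c T P W g"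
proof -
  have "(t, coord c x) \<in> time_ivl T \<times> crange c"
    using assms by auto
  then obtain W g where W: "open W" "(t, coord c x) \<in> W" "\<forall>k. Ck_on k g W"
    "\<forall>z\<in>(time_ivl T \<times> crange c) \<inter> W. g z = (case z of (t, y) \<Rightarrow> P t (param c y))"
    using assms(2) unfolding smooth_in_def smooth_on_def by blast
  let ?W = "W \<inter> UNIV \<times> crange c"
  have "open ?W"
    using W(1) is_chart_open_crange[OF assms(1)] by (intro open_Int open_Times) auto
  moreover have "\<forall>k. Ck_on k g ?W"
    using W(3) Ck_on_subset by blast
  ultimately have "local_extension c T P ?W g"
    using W(4) by (force simp: local_extension_def)
  then show thesis
    using that[of ?W g] W(2) assms(4) by auto
qed

lemma local_extension_subset:
  "local_extension c T P W g \<Longrightarrow> open W' \<Longrightarrow> W' \<subseteq> W \<Longrightarrow> local_extension c T P W' g"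
  unfolding local_extension_def using Ck_on_subset by blast

lemma local_extension_has_derivative:
  assumes "local_extension c T P W g" "z \<in> W"
  shows "(g has_derivative frechet_derivative g (at z)) (at z)"
  using assms by (intro Ck_on_Suc_has_derivative[of 0 g W]) (simp_all only: local_extension_def)

text \<open>For a fixed admissible time the slice of \<open>W\<close> is open in space and
  \<open>P\<close> agrees with \<open>g\<close> on all of it, so the spatial derivative is a full
  one.\<close>

lemma local_extension_param_has_derivative:
  assumes ext: "local_extension c T P W g" and "s \<in> time_ivl T" "(s, y) \<in> W"
  shows "((P s \<circ> param c) has_derivative (\<lambda>v. frechet_derivative g (at (s, y)) (0, v))) (at y)"
proof -
  have "((\<lambda>y. (s, y)) has_derivative (\<lambda>v. (0, v))) (at y)"
    by (auto intro!: derivative_eq_intros)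
  from has_derivative_compose[OF this local_extension_has_derivative[OF ext \<open>(s, y) \<in> W\<close>]]
  have "((\<lambda>y. g (s, y)) has_derivative (\<lambda>v. frechet_derivative g (at (s, y)) (0, v))) (at y)" .
  moreover have "open ((\<lambda>y. (s, y)) -` W)"
    using ext by (intro open_vimage continuous_intros) (auto simp: local_extension_def)
  moreover have "y \<in> (\<lambda>y. (s, y)) -` W"
    using assms(3) by simp
  ultimately show ?thesis
  proof (rule has_derivative_transform_within_open)
    show "g (s, y') = (P s \<circ> param c) y'" if "y' \<in> (\<lambda>y. (s, y)) -` W" for y'
      using that assms(1,2) by (simp add: local_extension_def)
  qed
qed

lemma local_extension_pd_eq:
  assumes "is_chart c" and ext: "local_extension c T P W g" and "s \<in> time_ivl T" "(s, y) \<in> W"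
  shows "pd c i (P s) (param c y) = frechet_derivative g (at (s, y)) (0, axis i 1)"
proof -
  have "y \<in> crange c"
    using ext \<open>(s, y) \<in> W\<close> unfolding local_extension_def by blast
  then have "coord c (param c y) = y"
    using is_chart_coord_param[OF assms(1)] by blast
  then show ?thesis
    using frechet_derivative_at[OF local_extension_param_has_derivative[OF assms(2-)]]
    by (metis pd_def)
qed

text \<open>The chain rule gives a two-sided derivative for \<open>g\<close>. It passes to
  \<open>P\<close> only within the time interval, because the two maps are related at those times
  alone.\<close>

lemma local_extension_time_derivative:
  assumes ext: "local_extension c T P W g" and "s \<in> time_ivl T" "(s, y) \<in> W"
  shows "((\<lambda>s. P s (param c y)) has_vector_derivative frechet_derivative g (at (s, y)) (1, 0))
    (at s within time_ivl T)"
proof -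
  let ?D = "frechet_derivative g (at (s, y))"
  have "((\<lambda>s. (s, y)) has_derivative (\<lambda>h. (h, 0))) (at s)"
    by (auto intro!: derivative_eq_intros)
  from has_derivative_compose[OF this local_extension_has_derivative[OF ext \<open>(s, y) \<in> W\<close>]]
  have "((\<lambda>s. g (s, y)) has_derivative (\<lambda>h. ?D (h, 0))) (at s)" .
  moreover have "(\<lambda>h. ?D (h, 0)) = (\<lambda>h. h *\<^sub>R ?D (1, 0))"
  proof
    fix h show "?D (h, 0) = h *\<^sub>R ?D (1, 0)"
      using linear_scale[OF has_derivative_linear[OF local_extension_has_derivative[OF ext \<open>(s, y) \<in> W\<close>]],
          of h "(1, 0)"]
      by simp
  qed
  ultimately have g: "((\<lambda>s. g (s, y)) has_vector_derivative ?D (1, 0)) (at s within time_ivl T)"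
    unfolding has_vector_derivative_def by (metis has_derivative_at_withinI)
  have "open ((\<lambda>s. (s, y)) -` W)"
    using ext by (intro open_vimage continuous_intros) (auto simp: local_extension_def)
  then obtain d where d: "d > 0" "ball s d \<subseteq> (\<lambda>s. (s, y)) -` W"
    using assms(3) openE[of "(\<lambda>s. (s, y)) -` W" s] by auto
  show ?thesis
  proof (rule has_vector_derivative_transform_within[OF g d(1) assms(2)])
    show "g (r, y) = P r (param c y)" if "r \<in> time_ivl T" "dist r s < d" for r
    proof -
      have "r \<in> ball s d" using that(2) by (simp add: dist_commute)
      then have "(r, y) \<in> W" using d(2) by blast
      then show ?thesis using ext that(1) by (simp add: local_extension_def)
    qed
  qed
qed

lemma local_extension_ddt_eq:
  assumes "local_extension c T P W g" "s \<in> time_ivl T" "(s, y) \<in> W"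
  shows "ddt T P s (param c y) = frechet_derivative g (at (s, y)) (1, 0)"
  unfolding ddt_def
  by (rule vector_derivative_within[OF at_within_time_ivl_neq_bot local_extension_time_derivative])
    (use assms in auto)

text \<open>Differentiating the extension extends the derivative, with the same \<open>W\<close>.
  Space and time derivatives can therefore be iterated on one neighbourhood.\<close>

lemma local_extension_pd:
  assumes "is_chart c" "local_extension c T P W g"
  shows "local_extension c T (\<lambda>t. pd c i (P t)) W (\<lambda>z. frechet_derivative g (at z) (0, axis i 1))"
proof -
  have "Ck_on k (\<lambda>z. frechet_derivative g (at z) (0, axis i 1)) W" for k
    using assms(2) Ck_on.simps(2)[of k g W] unfolding local_extension_def by blast
  then show ?thesis
    using assms(2) local_extension_pd_eq[OF assms] by (simp add: local_extension_def)
qed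

lemma local_extension_ddt:
  assumes "local_extension c T P W g"
  shows "local_extension c T (ddt T P) W (\<lambda>z. frechet_derivative g (at z) (1, 0))"
proof -
  have "Ck_on k (\<lambda>z. frechet_derivative g (at z) (1, 0)) W" for k
    using assms Ck_on.simps(2)[of k g W] unfolding local_extension_def by blast
  then show ?thesis
    using assms local_extension_ddt_eq[OF assms] by (simp add: local_extension_def)
qed

lemma local_extension_bilinear:
  assumes "bounded_bilinear B" "local_extension c T P W g" "local_extension c T Q W h"
  shows "local_extension c T (\<lambda>t x. B (P t x) (Q t x)) W (\<lambda>z. B (g z) (h z))"
  using assms(2,3) by (simp add: local_extension_def Ck_on_bilinear[OF assms(1)])

section \<open>Derivatives and products of maps that are smooth in a chart\<close>

lemma smooth_in_pd:
  assumes "is_chart c" "smooth_in c T P"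
  shows "smooth_in c T (\<lambda>t. pd c i (P t))"
proof (rule smooth_inI)
  fix t x assume "t \<in> time_ivl T" "x \<in> cdom c"
  then obtain W g where "(t, coord c x) \<in> W" "local_extension c T P W g"
    using smooth_inE[OF assms] by blast
  then show "\<exists>W g. (t, coord c x) \<in> W \<and> local_extension c T (\<lambda>t. pd c i (P t)) W g"
    using local_extension_pd[OF assms(1)] by blast
qed

lemma smooth_in_ddt:
  assumes "is_chart c" "smooth_in c T P"
  shows "smooth_in c T (ddt T P)"
proof (rule smooth_inI)
  fix t x assume "t \<in> time_ivl T" "x \<in> cdom c"
  then obtain W g where "(t, coord c x) \<in> W" "local_extension c T P W g"
    using smooth_inE[OF assms] by blast
  then show "\<exists>W g. (t, coord c x) \<in> W \<and> local_extension c T (ddt T P) W g"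
    using local_extension_ddt by blast
qed

lemma smooth_in_bilinear:
  assumes "bounded_bilinear B" "is_chart c" "smooth_in c T P" "smooth_in c T Q"
  shows "smooth_in c T (\<lambda>t x. B (P t x) (Q t x))"
proof (rule smooth_inI)
  fix t x assume tx: "t \<in> time_ivl T" "x \<in> cdom c"
  obtain W g where W: "(t, coord c x) \<in> W" "local_extension c T P W g"
    using smooth_inE[OF assms(2,3) tx] .
  obtain V h where V: "(t, coord c x) \<in> V" "local_extension c T Q V h"
    using smooth_inE[OF assms(2,4) tx] .
  have "open (W \<inter> V)"
    using W V by (auto simp: local_extension_def)
  then have "local_extension c T (\<lambda>t x. B (P t x) (Q t x)) (W \<inter> V) (\<lambda>z. B (g z) (h z))"
    by (intro local_extension_bilinear[OF assms(1)] local_extension_subset[OF W(2)]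
        local_extension_subset[OF V(2)]) auto
  then show "\<exists>W g. (t, coord c x) \<in> W \<and> local_extension c T (\<lambda>t x. B (P t x) (Q t x)) W g"
    using W(1) V(1) by blast
qed

lemmas smooth_in_inner = smooth_in_bilinear[OF bounded_bilinear_inner]

lemma smooth_in_has_time_derivative:
  assumes "is_chart c" "smooth_in c T P" "t \<in> time_ivl T" "x \<in> cdom c"
  shows "((\<lambda>s. P s x) has_vector_derivative ddt T P t x) (at t within time_ivl T)"
proof -
  obtain W g where W: "(t, coord c x) \<in> W" "local_extension c T P W g"
    using smooth_inE[OF assms] .
  show ?thesis
    using local_extension_time_derivative[OF W(2) assms(3) W(1)]
      local_extension_ddt_eq[OF W(2) assms(3) W(1)]
    by (simp add: is_chart_param_coord[OF assms(1,4)])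
qed

lemma smooth_in_continuous_in_time:
  assumes "is_chart c" "smooth_in c T P" "x \<in> cdom c"
  shows "continuous_on (time_ivl T) (\<lambda>t. P t x)"
  unfolding continuous_on_eq_continuous_within
  using has_vector_derivative_continuous[OF smooth_in_has_time_derivative[OF assms(1,2) _ assms(3)]]
  by blast

lemma smooth_in_param_has_derivative:
  assumes "is_chart c" "smooth_in c T P" "t \<in> time_ivl T" "x \<in> cdom c"
  shows "((P t \<circ> param c) has_derivative frechet_derivative (P t \<circ> param c) (at (coord c x)))
    (at (coord c x))"
proof -
  obtain W g where W: "(t, coord c x) \<in> W" "local_extension c T P W g"
    using smooth_inE[OF assms] .
  from local_extension_param_has_derivative[OF W(2) assms(3) W(1)] show ?thesis
    by (simp add: frechet_derivative_at[symmetric])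
qed

text \<open>Both sides are mixed second derivatives of the same extension \<open>g\<close>, which
  commute. This covers time 0 as well, although \<open>ddt\<close> is one-sided there.\<close>

lemma ddt_pd_commute:
  assumes "is_chart c" "smooth_in c T P" "t \<in> time_ivl T" "x \<in> cdom c"
  shows "ddt T (\<lambda>t. pd c i (P t)) t x = pd c i (ddt T P t) x"
proof -
  obtain W g where W: "(t, coord c x) \<in> W" "local_extension c T P W g"
    using smooth_inE[OF assms] .
  have "ddt T (\<lambda>t. pd c i (P t)) t (param c (coord c x)) = pd c i (ddt T P t) (param c (coord c x))"
    unfolding local_extension_ddt_eq[OF local_extension_pd[OF assms(1) W(2)] assms(3) W(1)]
      local_extension_pd_eq[OF assms(1) local_extension_ddt[OF W(2)] assms(3) W(1)]
    using W by (intro Ck_on_mixed_derivatives_commute[of _ W]) (auto simp: local_extension_def)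
  then show ?thesis
    by (simp add: is_chart_param_coord[OF assms(1,4)])
qed

section \<open>Geometry of a hypersurface at a fixed time\<close>

text \<open>The metric is the Gram matrix of the vectors \<open>D (axis i 1)\<close>, so its
  quadratic form at \<open>a\<close> is the squared norm of \<open>D a\<close>; injectivity of
  \<open>D\<close> makes its kernel trivial.\<close>

lemma invertible_metric:
  fixes X :: "'m \<Rightarrow> 'b::euclidean_space" and c :: "('m, 'n::finite) chart" and x :: 'm
  defines "D \<equiv> frechet_derivative (X \<circ> param c) (at (coord c x))"
  assumes "linear D" "inj D"
  shows "invertible (metric c X x)"
  unfolding invertible_left_inverse matrix_left_invertible_ker
proof (intro allI impI)
  fix a :: "real ^ 'n"
  assume a: "metric c X x *v a = 0"
  have "D a = (\<Sum>i\<in>UNIV. a $ i *\<^sub>R D (axis i 1))"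
    by (rule linear_axis_expansion[OF \<open>linear D\<close>])
  then have "D a \<bullet> D a = (\<Sum>i\<in>UNIV. \<Sum>j\<in>UNIV. a $ i * (a $ j * (D (axis i 1) \<bullet> D (axis j 1))))"
    by (simp add: inner_sum_left inner_sum_right sum_distrib_left inner_commute mult.left_commute)
  also have "\<dots> = a \<bullet> (metric c X x *v a)"
    by (simp add: inner_vec_def matrix_vector_mult_def metric_def pd_def D_def sum_distrib_left mult_ac)
  finally have "D a = D 0"
    using a linear_0[OF \<open>linear D\<close>] by simp
  then show "a = 0"
    using \<open>inj D\<close> by (simp add: inj_eq)
qed

text \<open>Lowering a raised index undoes it, since the metric times its inverse is the identity.
  Pairing a tangent vector with a coordinate vector thus recovers the components of the
  form.\<close>

lemma sum_raise_index_metric: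
  assumes "invertible (metric c X x)"
  shows "(\<Sum>k\<in>UNIV. raise_index c X \<omega> k x * (pd c k X x \<bullet> pd c i X x)) = \<omega> i x"
proof -
  have inv: "(\<Sum>k\<in>UNIV. (pd c k X x \<bullet> pd c i X x) * metric_inv c X x $ k $ j) = (if i = j then 1 else 0)" for j
  proof -
    have "(metric c X x ** metric_inv c X x) $ i $ j = mat 1 $ i $ j"
      using assms by (simp add: metric_inv_def matrix_inv_right)
    then show ?thesis
      by (simp add: matrix_matrix_mult_def mat_def metric_def inner_commute)
  qed
  have "(\<Sum>k\<in>UNIV. raise_index c X \<omega> k x * (pd c k X x \<bullet> pd c i X x)) =
      (\<Sum>j\<in>UNIV. (\<Sum>k\<in>UNIV. (pd c k X x \<bullet> pd c i X x) * metric_inv c X x $ k $ j) * \<omega> j x)"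
    unfolding raise_index_def sum_distrib_right by (subst sum.swap) (simp add: mult_ac)
  also have "\<dots> = \<omega> i x"
    by (simp add: inv if_distrib[of "\<lambda>r. r * _"] cong: if_cong)
  finally show ?thesis .
qed

lemma gradient_inner_pd:
  "invertible (metric c X x) \<Longrightarrow> gradient c X p x \<bullet> pd c i X x = pd c i p x"
  by (simp add: gradient_def inner_sum_left grad_comp_def sum_raise_index_metric)

text \<open>The normal term is killed by the pairing, and lowering the index in the tangential term
  leaves a scalar coefficient times the component of \<open>S\<close>, minus the derivative of the
  energy.\<close>

lemma HMCF_rhs_inner_pd:
  fixes c :: "('m, 'n::finite) chart"
  assumes "invertible (metric c X x)" "N x \<bullet> pd c i X x = 0"
  shows "HMCF_rhs c X N V x \<bullet> pd c i X x =
    (normal_speed V N x * mean_curvature c X N x - div_form c X (tan_form c X V) x) *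
      tan_form c X V i x - pd c i (energy CARD('n) V) x"
  using assms(2)
  by (simp add: HMCF_rhs_def Let_def inner_add_left inner_sum_left left_diff_distrib sum_subtractf
      mult.assoc grad_comp_def sum_raise_index_metric[OF assms(1)] flip: sum_distrib_left)

lemma pd_energy:
  assumes "param c (coord c x) = x"
    and V: "(V \<circ> param c) differentiable (at (coord c x))"
  shows "pd c i (energy n V) x = V x \<bullet> pd c i V x"
proof -
  define u a D where "u = V \<circ> param c" and "a = coord c x" and "D = frechet_derivative u (at a)"
  have D: "(u has_derivative D) (at a)"
    using V unfolding u_def a_def D_def by (simp add: frechet_derivative_works)
  have "((\<lambda>y. (1/2) * (u y \<bullet> u y + real n)) has_derivative
      (\<lambda>v. (1/2) * (u a \<bullet> D v + D v \<bullet> u a + 0))) (at a)"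
    by (intro has_derivative_mult_right has_derivative_add has_derivative_inner has_derivative_const D)
  \<comment> \<open>The squared norm is written as an inner product because the velocity may vanish,
    where the norm itself is not differentiable.\<close>
  moreover have "energy n V \<circ> param c = (\<lambda>y. (1/2) * (u y \<bullet> u y + real n))"
    by (simp add: energy_def power2_norm_eq_inner u_def comp_def)
  ultimately have "frechet_derivative (energy n V \<circ> param c) (at a) =
      (\<lambda>v. (1/2) * (u a \<bullet> D v + D v \<bullet> u a + 0))"
    using frechet_derivative_at[symmetric] by simp
  then show ?thesis
    using assms(1) by (simp add: pd_def u_def a_def D_def inner_commute)
qed

lemma pd_eq_0:
  assumes "is_chart c" "x \<in> cdom c" "\<And>y. y \<in> cdom c \<Longrightarrow> P y = 0"
  shows "pd c i P x = 0"
proof -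
  have "((\<lambda>y. 0) has_derivative (\<lambda>v. 0)) (at (coord c x))"
    by simp
  then have "((P \<circ> param c) has_derivative (\<lambda>v. 0)) (at (coord c x))"
    by (rule has_derivative_transform_within_open[OF _ is_chart_open_crange[OF assms(1)]])
      (use assms is_chart_coord_param[OF assms(1)] in auto)
  from frechet_derivative_at[OF this] show ?thesis
    by (metis pd_def)
qed

text \<open>The divergence of \<open>S\<close> contains its spatial derivatives, so \<open>S\<close>
  is assumed to vanish on the whole chart domain and not just at \<open>x\<close>.\<close>

lemma HMCF_rhs_normal_velocity:
  fixes c :: "('m::topological_space, 'n::finite) chart"
  assumes "is_chart c" "x \<in> cdom c" "\<And>y i. y \<in> cdom c \<Longrightarrow> tan_form c X V i y = 0"
  shows "HMCF_rhs c X N V x =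
    (energy CARD('n) V x * mean_curvature c X N x) *\<^sub>R N x - gradient c X (energy CARD('n) V) x"
proof -
  have "pd c i (tan_form c X V j) x = 0" for i j
    using assms by (intro pd_eq_0) auto
  then show ?thesis
    using assms(2,3)
    by (simp add: HMCF_rhs_def Let_def div_form_def nabla_form_def form_norm_sq_def raise_index_def
        gradient_def sum_negf)
qed

text \<open>In codimension one the orthogonal complement of \<open>range D\<close> is a line. If
  \<open>w\<close> were not a multiple of \<open>\<nu>\<close>, its part \<open>u\<close> orthogonal
  to \<open>\<nu>\<close> would give two independent vectors on that line.\<close>

lemma normal_to_hyperplane:
  fixes D :: "real ^ 'n \<Rightarrow> real ^ 'k" and \<nu> w :: "real ^ 'k"
  assumes dim: "CARD('k) = CARD('n) + 1"
    and D: "linear D" "inj D"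
    and \<nu>: "norm \<nu> = 1" "\<And>i. \<nu> \<bullet> D (axis i 1) = 0"
    and w: "\<And>i. w \<bullet> D (axis i 1) = 0"
  shows "w = (w \<bullet> \<nu>) *\<^sub>R \<nu>"
proof (rule ccontr)
  assume ne: "w \<noteq> (w \<bullet> \<nu>) *\<^sub>R \<nu>"
  define u where "u = w - (w \<bullet> \<nu>) *\<^sub>R \<nu>"
  define U where "U = {y. \<forall>z\<in>range D. orthogonal z y}"
  have "dim (range D) = CARD('n)"
    using dim_image_eq[of D UNIV] D by (simp add: inj_on_subset)
  moreover have "dim U + dim (range D) = CARD('k)"
    using dim_subspace_orthogonal_to_vectors[of "range D" UNIV] linear_subspace_image[OF D(1) subspace_UNIV]
    by (simp add: U_def)
  ultimately have "dim U = 1"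
    using dim by simp
  have inU: "y \<in> U" if "\<And>i. y \<bullet> D (axis i 1) = 0" for y
  proof -
    have "y \<bullet> D a = 0" for a
      unfolding linear_axis_expansion[OF D(1), of a] by (simp add: inner_sum_right that)
    then show ?thesis
      by (auto simp: U_def orthogonal_def inner_commute)
  qed
  have "\<nu> \<bullet> \<nu> = 1"
    using \<nu>(1) by (simp add: dot_square_norm)
  then have "u \<bullet> \<nu> = 0"
    by (simp add: u_def inner_diff_left)
  have "u \<noteq> 0" "\<nu> \<noteq> 0"
    using ne \<nu>(1) by (auto simp: u_def)
  have "u \<noteq> \<nu>"
    using \<open>u \<bullet> \<nu> = 0\<close> \<open>\<nu> \<bullet> \<nu> = 1\<close> by auto
  have "independent {u, \<nu>}"
    using \<open>u \<bullet> \<nu> = 0\<close> \<open>u \<noteq> 0\<close> \<open>\<nu> \<noteq> 0\<close>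
    by (intro pairwise_orthogonal_independent)
      (auto simp: pairwise_def orthogonal_def inner_commute)
  moreover have "{u, \<nu>} \<subseteq> U"
    using \<nu>(2) w by (auto intro!: inU simp: u_def inner_diff_left)
  ultimately have "card {u, \<nu>} \<le> dim U"
    by (rule independent_card_le_dim[rotated])
  then show False
    using \<open>u \<noteq> \<nu>\<close> \<open>dim U = 1\<close> by simp
qed

section \<open>The tangential velocity along a flow\<close>

text \<open>The evolution of \<open>S\<close> is studied in one chart at a time; the theorem
  instantiates this for every chart of the atlas.\<close>

locale hypersurface_flow_in_chart =
  fixes c :: "('m::topological_space, 'n::finite) chart"
    and T :: ereal
    and F \<nu> :: "real \<Rightarrow> 'm \<Rightarrow> 'b::euclidean_space"
  assumes chart: "is_chart c"
    and smooth_F: "smooth_in c T F"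
    and smooth_\<nu>: "smooth_in c T \<nu>"
    and inj_F: "\<And>t x. t \<in> time_ivl T \<Longrightarrow> x \<in> cdom c \<Longrightarrow>
      inj (frechet_derivative (F t \<circ> param c) (at (coord c x)))"
    and unit: "\<And>t x. t \<in> time_ivl T \<Longrightarrow> x \<in> cdom c \<Longrightarrow> norm (\<nu> t x) = 1"
    and normal: "\<And>t x i. t \<in> time_ivl T \<Longrightarrow> x \<in> cdom c \<Longrightarrow> \<nu> t x \<bullet> pd c i (F t) x = 0"
begin

lemma linear_F:
  "t \<in> time_ivl T \<Longrightarrow> x \<in> cdom c \<Longrightarrow> linear (frechet_derivative (F t \<circ> param c) (at (coord c x)))"
  using smooth_in_param_has_derivative[OF chart smooth_F] has_derivative_linear by blast

lemma invertible_metric_F: "t \<in> time_ivl T \<Longrightarrow> x \<in> cdom c \<Longrightarrow> invertible (metric c (F t) x)"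
  by (intro invertible_metric linear_F inj_F)

lemma smooth_metric: "smooth_in c T (\<lambda>t y. metric c (F t) y $ i $ j)"
  using smooth_in_inner[OF chart smooth_in_pd[OF chart smooth_F, of i] smooth_in_pd[OF chart smooth_F, of j]]
  by (simp add: metric_def)

lemma smooth_tan_form: "smooth_in c T (\<lambda>t. tan_form c (F t) (ddt T F t) i)"
  using smooth_in_inner[OF chart smooth_in_ddt[OF chart smooth_F] smooth_in_pd[OF chart smooth_F, of i]]
  by (simp add: tan_form_def[abs_def])

lemma smooth_normal_speed: "smooth_in c T (\<lambda>t. normal_speed (ddt T F t) (\<nu> t))"
  using smooth_in_inner[OF chart smooth_in_ddt[OF chart smooth_F] smooth_\<nu>]
  by (simp add: normal_speed_def[abs_def])

section \<open>Evolution in time at a fixed point of the manifold\<close>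

context
  fixes x assumes x: "x \<in> cdom c"
begin

lemmas continuous_in_time = smooth_in_continuous_in_time[OF chart _ x]

lemma continuous_metric_inv: "continuous_on (time_ivl T) (\<lambda>t. metric_inv c (F t) x $ i $ j)"
  unfolding metric_inv_def
  by (intro continuous_on_matrix_inv continuous_in_time[OF smooth_metric] invertible_metric_F x)

lemma continuous_mean_curvature: "continuous_on (time_ivl T) (\<lambda>t. mean_curvature c (F t) (\<nu> t) x)"
  unfolding mean_curvature_def second_form_def
  by (simp, intro continuous_intros continuous_metric_inv continuous_in_time smooth_in_pd chart
      smooth_F smooth_\<nu>)

lemma continuous_christoffel: "continuous_on (time_ivl T) (\<lambda>t. christoffel c (F t) k i j x)"
  unfolding christoffel_def
  by (intro continuous_intros continuous_metric_inv continuous_in_time smooth_in_pd chart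
      smooth_metric) simp

text \<open>Although the divergence involves derivatives of the unknown \<open>S\<close>, the flow
  is given and smooth, so along it the divergence is just a continuous function of time and can
  serve as a coefficient.\<close>

lemma continuous_div_form:
  "continuous_on (time_ivl T) (\<lambda>t. div_form c (F t) (tan_form c (F t) (ddt T F t)) x)"
  unfolding div_form_def nabla_form_def
  by (intro continuous_intros continuous_metric_inv continuous_in_time smooth_in_pd chart
      smooth_tan_form continuous_christoffel)

text \<open>The product rule yields a second term, velocity paired with \<open>pd c i\<close> of the
  velocity, which is exactly the energy derivative subtracted in \<open>eq\<close>. The free
  \<open>r\<close> lets both flow equations use the same computation.\<close>

lemma tan_form_has_time_derivative:
  assumes t: "t \<in> time_ivl T"
    and eq: "ddt T (ddt T F) t x \<bullet> pd c i (F t) x = r - pd c i (energy n (ddt T F t)) x"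
  shows "((\<lambda>t. tan_form c (F t) (ddt T F t) i x) has_vector_derivative r) (at t within time_ivl T)"
proof -
  note smooth_V = smooth_in_ddt[OF chart smooth_F]
  have "((\<lambda>t. ddt T F t x \<bullet> pd c i (F t) x) has_vector_derivative
      ddt T F t x \<bullet> ddt T (\<lambda>t. pd c i (F t)) t x + ddt T (ddt T F) t x \<bullet> pd c i (F t) x)
      (at t within time_ivl T)"
    by (rule bounded_bilinear.has_vector_derivative[OF bounded_bilinear_inner
          smooth_in_has_time_derivative[OF chart smooth_V t x]
          smooth_in_has_time_derivative[OF chart smooth_in_pd[OF chart smooth_F] t x]])
  moreover have "pd c i (energy n (ddt T F t)) x = ddt T F t x \<bullet> pd c i (ddt T F t) x"
    using smooth_in_param_has_derivative[OF chart smooth_V t x] is_chart_param_coord[OF chart x]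
    by (intro pd_energy differentiableI) auto
  ultimately show ?thesis
    using eq by (simp add: tan_form_def ddt_pd_commute[OF chart smooth_F t x])
qed

lemma tan_form_zero:
  assumes "t \<in> time_ivl T"
    and "continuous_on (time_ivl T) b"
    and "\<And>t. t \<in> time_ivl T \<Longrightarrow> ddt T (ddt T F) t x \<bullet> pd c i (F t) x =
      b t * tan_form c (F t) (ddt T F t) i x - pd c i (energy n (ddt T F t)) x"
    and "tan_form c (F 0) (ddt T F 0) i x = 0"
  shows "tan_form c (F t) (ddt T F t) i x = 0"
  by (rule linear_ode_zero[OF assms(1,2) tan_form_has_time_derivative[OF _ assms(3)] assms(4)])

end

end

theorem corollary4p5:
  fixes A :: "('m::{t2_space,second_countable_topology}, 'n::finite) chart set"
    and T :: ereal
    and F0 :: "'m \<Rightarrow> real ^ 'k"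
    and f :: "'m \<Rightarrow> real"
    and F \<nu> :: "real \<Rightarrow> 'm \<Rightarrow> real ^ 'k"
  assumes dim: "CARD('k) = CARD('n) + 1"
    and M: "orientable_smooth_manifold A"
    and F0: "immersion A F0"
    and T: "0 < T"
    and flow: "is_flow A T F"
    and normal: "unit_normal A T F \<nu>"
    and init_pos: "\<forall>x. F 0 x = F0 x"
    and init_vel: "\<forall>x. ddt T F 0 x = f x *\<^sub>R \<nu> 0 x"
  shows "(HMCF A T F \<nu> \<longleftrightarrow> HMCF' A T F \<nu>) \<and>
    (HMCF' A T F \<nu> \<longrightarrow>
      (\<forall>t\<in>time_ivl T. \<forall>c\<in>A. \<forall>x\<in>cdom c. \<forall>i. tan_form c (F t) (ddt T F t) i x = 0) \<and>
      (\<exists>\<sigma> :: real \<Rightarrow> 'm \<Rightarrow> real. smooth_family A T \<sigma> \<and> (\<forall>x. \<sigma> 0 x = f x) \<and>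
        (\<forall>t\<in>time_ivl T. \<forall>x. ddt T F t x = \<sigma> t x *\<^sub>R \<nu> t x)))"
proof -
  have cover: "\<exists>c\<in>A. x \<in> cdom c" for x
    using M unfolding orientable_smooth_manifold_def smooth_atlas_def by blast
  have in_chart: "hypersurface_flow_in_chart c T F \<nu>" if "c \<in> A" for c
  proof
    show "is_chart c"
      using M that unfolding orientable_smooth_manifold_def smooth_atlas_def by blast
    show "smooth_in c T F" "smooth_in c T \<nu>"
      using flow normal that by (auto simp: is_flow_def unit_normal_def smooth_family_iff_smooth_in)
    show "inj (frechet_derivative (F t \<circ> param c) (at (coord c x)))"
      if "t \<in> time_ivl T" "x \<in> cdom c" for t x
      using flow that \<open>c \<in> A\<close> unfolding is_flow_def immersion_def by blast
    show "norm (\<nu> t x) = 1" "\<nu> t x \<bullet> pd c i (F t) x = 0" if "t \<in> time_ivl T" "x \<in> cdom c" for t x i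
      using normal that \<open>c \<in> A\<close> unfolding unit_normal_def by blast+
  qed
  have zero: "0 \<in> time_ivl T"
    using T by (simp add: time_ivl_def zero_ereal_def)
  have unit: "norm (\<nu> t x) = 1" if "t \<in> time_ivl T" for t x
    using cover[of x] hypersurface_flow_in_chart.unit[OF in_chart that] by blast
  have initially_normal: "tan_form c (F 0) (ddt T F 0) i x = 0" if "c \<in> A" "x \<in> cdom c" for c x i
    using hypersurface_flow_in_chart.normal[OF in_chart[OF that(1)] zero that(2)] init_vel
    by (simp add: tan_form_def)
  have S_zero: "tan_form c (F t) (ddt T F t) i x = 0"
    if eq: "HMCF A T F \<nu> \<or> HMCF' A T F \<nu>" and "c \<in> A" "x \<in> cdom c" "t \<in> time_ivl T" for c x t i
  proof -
    interpret hypersurface_flow_in_chart c T F \<nu>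
      by (rule in_chart) fact
    \<comment> \<open>The two open places are the continuity of the coefficient \<open>b\<close> and
      the evolution identity, supplied separately for each equation. The number \<open>n\<close>
      occurs only in a premise, so it is fixed here.\<close>
    note S = tan_form_zero[OF \<open>x \<in> cdom c\<close> \<open>t \<in> time_ivl T\<close> _ _
        initially_normal[OF \<open>c \<in> A\<close> \<open>x \<in> cdom c\<close>], where n = "CARD('n)"]
    from eq show ?thesis
    proof
      assume H: "HMCF A T F \<nu>"
      show ?thesis
      proof (rule S)
        show "continuous_on (time_ivl T) (\<lambda>t. normal_speed (ddt T F t) (\<nu> t) x *
            mean_curvature c (F t) (\<nu> t) x - div_form c (F t) (tan_form c (F t) (ddt T F t)) x)"
          by (intro continuous_intros continuous_mean_curvature continuous_div_form
              continuous_in_time smooth_normal_speed) fact+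
      next
        fix t assume t: "t \<in> time_ivl T"
        with H \<open>c \<in> A\<close> \<open>x \<in> cdom c\<close>
        have "ddt T (ddt T F) t x = HMCF_rhs c (F t) (\<nu> t) (ddt T F t) x"
          by (simp add: HMCF_def)
        then show "ddt T (ddt T F) t x \<bullet> pd c i (F t) x =
            (normal_speed (ddt T F t) (\<nu> t) x * mean_curvature c (F t) (\<nu> t) x
              - div_form c (F t) (tan_form c (F t) (ddt T F t)) x)
            * tan_form c (F t) (ddt T F t) i x - pd c i (energy CARD('n) (ddt T F t)) x"
          by (simp only: HMCF_rhs_inner_pd[where N = "\<nu> t", OF invertible_metric_F[OF t \<open>x \<in> cdom c\<close>]
                normal[OF t \<open>x \<in> cdom c\<close>]])
      qed
    next
      assume H: "HMCF' A T F \<nu>"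
      show ?thesis
      proof (rule S)
        fix t assume t: "t \<in> time_ivl T"
        let ?e = "energy CARD('n) (ddt T F t)"
        from t H \<open>c \<in> A\<close> \<open>x \<in> cdom c\<close>
        have "ddt T (ddt T F) t x =
            (?e x * mean_curvature c (F t) (\<nu> t) x) *\<^sub>R \<nu> t x - gradient c (F t) ?e x"
          by (simp add: HMCF'_def Let_def)
        \<comment> \<open>The normal term drops out, so the coefficient \<open>b\<close> is the
          constant 0; its continuity is left to the closing \<open>simp\<close>.\<close>
        then show "ddt T (ddt T F) t x \<bullet> pd c i (F t) x =
            0 * tan_form c (F t) (ddt T F t) i x - pd c i ?e x"
          by (simp add: inner_diff_left normal[OF t \<open>x \<in> cdom c\<close>]
              gradient_inner_pd[OF invertible_metric_F[OF t \<open>x \<in> cdom c\<close>]])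
      qed simp
    qed
  qed
  \<comment> \<open>Either equation forces \<open>S = 0\<close> throughout the chart, so this one
    identity serves both directions of the equivalence.\<close>
  have rhs_eq: "HMCF_rhs c (F t) (\<nu> t) (ddt T F t) x =
      (let e = energy CARD('n) (ddt T F t)
       in (e x * mean_curvature c (F t) (\<nu> t) x) *\<^sub>R \<nu> t x - gradient c (F t) e x)"
    if eq: "HMCF A T F \<nu> \<or> HMCF' A T F \<nu>" and "c \<in> A" "x \<in> cdom c" "t \<in> time_ivl T" for c x t
    using HMCF_rhs_normal_velocity[OF hypersurface_flow_in_chart.chart[OF in_chart[OF \<open>c \<in> A\<close>]]
        \<open>x \<in> cdom c\<close> S_zero[OF eq \<open>c \<in> A\<close> _ \<open>t \<in> time_ivl T\<close>]]
    by (simp add: Let_def)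
  have "tangential_part (\<nu> 0) (ddt T F 0) x = 0" for x
    using init_vel unit[OF zero, of x] by (simp add: tangential_part_def dot_square_norm)
  then have "HMCF A T F \<nu> \<longleftrightarrow> HMCF' A T F \<nu>"
    using rhs_eq unfolding HMCF_def HMCF'_def by (metis (no_types, lifting))
  moreover have "\<exists>\<sigma> :: real \<Rightarrow> 'm \<Rightarrow> real. smooth_family A T \<sigma> \<and> (\<forall>x. \<sigma> 0 x = f x) \<and>
      (\<forall>t\<in>time_ivl T. \<forall>x. ddt T F t x = \<sigma> t x *\<^sub>R \<nu> t x)" if H: "HMCF' A T F \<nu>"
  \<comment> \<open>The only possible witness is the normal speed, as pairing the required identity
    with the unit vector \<open>\<nu> t x\<close> shows.\<close>
  proof (intro exI conjI allI ballI)
    show "smooth_family A T (\<lambda>t. normal_speed (ddt T F t) (\<nu> t))"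
      using hypersurface_flow_in_chart.smooth_normal_speed[OF in_chart]
      by (simp add: smooth_family_iff_smooth_in)
    show "normal_speed (ddt T F 0) (\<nu> 0) x = f x" for x
      using init_vel unit[OF zero, of x] by (simp add: normal_speed_def dot_square_norm)
    show "ddt T F t x = normal_speed (ddt T F t) (\<nu> t) x *\<^sub>R \<nu> t x" if t: "t \<in> time_ivl T" for t x
    proof -
      obtain c where c: "c \<in> A" "x \<in> cdom c"
        using cover by blast
      interpret hypersurface_flow_in_chart c T F \<nu>
        by (rule in_chart) fact
      \<comment> \<open>Vanishing \<open>S\<close> makes the velocity orthogonal to every coordinate
        tangent vector; by \<open>dim\<close> the hypersurface has codimension one, so the velocity
        is a multiple of the normal.\<close>
      show ?thesis
        unfolding normal_speed_def
        using S_zero[OF disjI2[OF H] c t] normal[OF t c(2)]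
        by (intro normal_to_hyperplane[OF dim linear_F[OF t c(2)] inj_F[OF t c(2)] unit[OF t c(2)]])
          (simp_all add: tan_form_def pd_def)
    qed
  qed
  ultimately show ?thesis
    using S_zero by blast
qed

end
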